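(* Let $(W,S)$ be a Coxeter system with set of reflections $T$, let $s_0 \in S$, and let $\langle s_0 \rangle$ be the two-element subgroup of $W$ generated by $s_0$. Then the partially ordered sets $\mathrm{Abs}_0(W^+)$ and $\mathrm{Abs}(W/\langle s_0 \rangle)$ are isomorphic.
   Context: $T = \{wsw^{-1} : w \in W, s \in S\}$. $W^+$ is the alternating subgroup of $W$, i.e. the kernel of the sign character $W \to \{1,-1\}$ which maps every element of $S$ to $-1$. $T_0 := \{s_0 t : t \in T\} \subseteq W^+$. For a generating set $A$ of a group, $\ell_A(g)$ denotes the minimum $k$ such that $g$ is a product of $k$ elements of $A$; thus $\ell_T$ is the absolute length on $W$ and $\ell_{T_0}$ is the length on $W^+$ with respect to $T_0$ (which is closed under inverses). $\mathrm{Abs}_0(W^+)$ is the partial order $\le_{T_0}$ on $W^+$ defined as the reflexive and transitive closure of the relation consisting of the pairs $(u,v)$ of elements of $W^+$ with $\ell_{T_0}(u) < \ell_{T_0}(v)$ and $v = \tau u$ for some $\tau \in T_0$. For a subgroup $H$ of $W$ and $X = W/H$ the set of left cosets, $\ell_T(x) := \min\{\ell_T(w) : w \in x\}$ for $x \in X$, and $\mathrm{Abs}(X) = (X,\le_T)$ is the partial order with $x \le_T y$ iff there exists $w \in W$ with $y = wx$ and $\ell_T(w) = \ell_T(y) - \ell_T(x)$. *)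

theory Defs
  imports "HOL-Algebra.Algebra" "HOL-Library.Extended_Nat"
begin

section \<open>Group presentations\<close>

text \<open>
  Words in the free group are lists of letters \<open>(s, b)\<close>, where \<open>(s, True)\<close> stands for the
  generator \<open>s\<close> and \<open>(s, False)\<close> for its formal inverse.
\<close>

type_synonym 'a group_word = "('a \<times> bool) list"

definition words :: "'a set \<Rightarrow> 'a group_word set"
  where "words S = lists (S \<times> UNIV)"

definition word_value :: "('a, 'b) monoid_scheme \<Rightarrow> 'a group_word \<Rightarrow> 'a"
  where "word_value G w =
    foldr (\<lambda>(s, b) g. (if b then s else inv\<^bsub>G\<^esub> s) \<otimes>\<^bsub>G\<^esub> g) w \<one>\<^bsub>G\<^esub>"

text \<open>
  Equality of the elements represented by two words in the group
  \<open>\<langle>S | r = 1 for all r \<in> R\<rangle>\<close>: the congruence on words generated by free cancellation and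
  by the relators.
\<close>

inductive presented_eq :: "'a set \<Rightarrow> 'a group_word set \<Rightarrow> 'a group_word \<Rightarrow> 'a group_word \<Rightarrow> bool"
  for S :: "'a set" and R :: "'a group_word set"
  where
    refl: "u \<in> words S \<Longrightarrow> presented_eq S R u u"
  | sym: "presented_eq S R u v \<Longrightarrow> presented_eq S R v u"
  | trans: "presented_eq S R u v \<Longrightarrow> presented_eq S R v w \<Longrightarrow> presented_eq S R u w"
  | cancel: "u \<in> words S \<Longrightarrow> v \<in> words S \<Longrightarrow> s \<in> S \<Longrightarrow>
      presented_eq S R (u @ [(s, b), (s, \<not> b)] @ v) (u @ v)"
  | relator: "u \<in> words S \<Longrightarrow> v \<in> words S \<Longrightarrow> r \<in> R \<Longrightarrow>
      presented_eq S R (u @ r @ v) (u @ v)"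

text \<open>
  The inclusion of \<open>S\<close> into \<open>G\<close> induces an isomorphism from \<open>\<langle>S | R\<rangle>\<close> onto \<open>G\<close>.
\<close>

definition has_presentation :: "('a, 'b) monoid_scheme \<Rightarrow> 'a set \<Rightarrow> 'a group_word set \<Rightarrow> bool"
  where "has_presentation G S R \<longleftrightarrow>
    group G \<and> S \<subseteq> carrier G \<and> R \<subseteq> words S \<and> generate G S = carrier G \<and>
    (\<forall>u \<in> words S. \<forall>v \<in> words S. word_value G u = word_value G v \<longleftrightarrow> presented_eq S R u v)"


section \<open>Coxeter systems\<close>

definition coxeter_matrix :: "'a set \<Rightarrow> ('a \<Rightarrow> 'a \<Rightarrow> enat) \<Rightarrow> bool"
  where "coxeter_matrix S m \<longleftrightarrow>
    (\<forall>s \<in> S. m s s = 1) \<and>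
    (\<forall>s \<in> S. \<forall>t \<in> S. m s t = m t s \<and> (s \<noteq> t \<longrightarrow> 2 \<le> m s t))"

text \<open>The relators \<open>(s t)^(m s t)\<close>; there is none for a pair with \<open>m s t = \<infinity>\<close>.\<close>

definition coxeter_relators :: "'a set \<Rightarrow> ('a \<Rightarrow> 'a \<Rightarrow> enat) \<Rightarrow> 'a group_word set"
  where "coxeter_relators S m =
    {concat (replicate n [(s, True), (t, True)]) | s t n. s \<in> S \<and> t \<in> S \<and> m s t = enat n}"

definition coxeter_system :: "('a, 'b) monoid_scheme \<Rightarrow> 'a set \<Rightarrow> bool"
  where "coxeter_system W S \<longleftrightarrow>
    (\<exists>m. coxeter_matrix S m \<and> has_presentation W S (coxeter_relators S m))"

definition reflections :: "('a, 'b) monoid_scheme \<Rightarrow> 'a set \<Rightarrow> 'a set"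
  where "reflections W S = {w \<otimes>\<^bsub>W\<^esub> s \<otimes>\<^bsub>W\<^esub> inv\<^bsub>W\<^esub> w | w s. w \<in> carrier W \<and> s \<in> S}"

text \<open>
  Values outside the carrier are fixed by extensionality, so that the character is unique as a
  function on the whole type.
\<close>

definition sign_character :: "('a, 'b) monoid_scheme \<Rightarrow> 'a set \<Rightarrow> 'a \<Rightarrow> int"
  where "sign_character W S =
    (THE \<epsilon>. \<epsilon> \<in> hom W sign_img \<and> \<epsilon> \<in> extensional (carrier W) \<and> (\<forall>s \<in> S. \<epsilon> s = -1))"

definition alternating_subgroup :: "('a, 'b) monoid_scheme \<Rightarrow> 'a set \<Rightarrow> 'a set"
  where "alternating_subgroup W S = kernel W sign_img (sign_character W S)"


section \<open>Word length\<close>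

definition word_length :: "('a, 'b) monoid_scheme \<Rightarrow> 'a set \<Rightarrow> 'a \<Rightarrow> nat"
  where "word_length G A g =
    (LEAST k. \<exists>as. length as = k \<and> set as \<subseteq> A \<and> g = foldr (\<otimes>\<^bsub>G\<^esub>) as \<one>\<^bsub>G\<^esub>)"


section \<open>The two partial orders\<close>

text \<open>
  Orders are \<open>gorder\<close> records with equality as \<open>eq\<close>; only \<open>le\<close> restricted to the carrier matters.
\<close>

definition T0 :: "('a, 'b) monoid_scheme \<Rightarrow> 'a set \<Rightarrow> 'a \<Rightarrow> 'a set"
  where "T0 W S s\<^sub>0 = {s\<^sub>0 \<otimes>\<^bsub>W\<^esub> t | t. t \<in> reflections W S}"

definition Abs0_step :: "('a, 'b) monoid_scheme \<Rightarrow> 'a set \<Rightarrow> 'a \<Rightarrow> ('a \<times> 'a) set"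
  where "Abs0_step W S s\<^sub>0 =
    {(u, v). u \<in> alternating_subgroup W S \<and> v \<in> alternating_subgroup W S \<and>
       word_length W (T0 W S s\<^sub>0) u < word_length W (T0 W S s\<^sub>0) v \<and>
       (\<exists>\<tau> \<in> T0 W S s\<^sub>0. v = \<tau> \<otimes>\<^bsub>W\<^esub> u)}"

definition Abs0 :: "('a, 'b) monoid_scheme \<Rightarrow> 'a set \<Rightarrow> 'a \<Rightarrow> 'a gorder"
  where "Abs0 W S s\<^sub>0 =
    \<lparr>carrier = alternating_subgroup W S, eq = (=),
     le = (\<lambda>u v. (u, v) \<in> (Abs0_step W S s\<^sub>0)\<^sup>*)\<rparr>"

definition coset_length :: "('a, 'b) monoid_scheme \<Rightarrow> 'a set \<Rightarrow> 'a set \<Rightarrow> nat"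
  where "coset_length W S x = (LEAST k. \<exists>w \<in> x. word_length W (reflections W S) w = k)"

text \<open>The lengths are compared in \<open>int\<close> because subtraction on \<open>nat\<close> truncates.\<close>

definition Abs :: "('a, 'b) monoid_scheme \<Rightarrow> 'a set \<Rightarrow> 'a set \<Rightarrow> 'a set gorder"
  where "Abs W S H =
    \<lparr>carrier = lcosets\<^bsub>W\<^esub> H, eq = (=),
     le = (\<lambda>x y. \<exists>w \<in> carrier W. y = w <#\<^bsub>W\<^esub> x \<and>
       int (word_length W (reflections W S) w) =
         int (coset_length W S y) - int (coset_length W S x))\<rparr>"

definition poset_isomorphic :: "'a gorder \<Rightarrow> 'b gorder \<Rightarrow> bool"
  where "poset_isomorphic P Q \<longleftrightarrow>
    partial_order P \<and> partial_order Q \<and>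
    (\<exists>f. bij_betw f (carrier P) (carrier Q) \<and>
      (\<forall>x \<in> carrier P. \<forall>y \<in> carrier P. x \<sqsubseteq>\<^bsub>P\<^esub> y \<longleftrightarrow> f x \<sqsubseteq>\<^bsub>Q\<^esub> f y))"

end

theory Submission
  imports Defs
begin

text \<open>
  Put \<open>H = {1, s\<^sub>0}\<close>. Every coset of \<open>H\<close> contains exactly one even element, so
  \<open>u \<mapsto> u\<inverse> H\<close> is a bijection from the alternating subgroup onto \<open>W / H\<close>. The inversion
  matters: left multiplication \<open>u \<mapsto> s\<^sub>0 t u\<close> becomes
  \<open>u\<inverse> H \<mapsto> u\<inverse> t s\<^sub>0 H = (u\<inverse> t u) u\<inverse> H\<close>, that is, left multiplication of cosets by a reflection.
  Comparing paths of length \<open>k\<close> from the identity shows that \<open>u\<close> is a product of \<open>k\<close> elements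
  of \<open>T\<^sub>0\<close> iff \<open>u\<inverse> H\<close> contains a product of \<open>k\<close> reflections, so lengths agree. Finally the order
  on \<open>W / H\<close> is generated by its length-increasing reflection steps, since one reflection raises
  the length by at most one.
\<close>

section \<open>Word products and length\<close>

text \<open>The number of factors is exactly \<open>k\<close>, not at most \<open>k\<close>.
  Isolating the predicate under \<open>LEAST\<close> allows induction on \<open>k\<close>.\<close>

definition is_word_product :: "('a, 'b) monoid_scheme \<Rightarrow> 'a set \<Rightarrow> nat \<Rightarrow> 'a \<Rightarrow> bool"
  where "is_word_product G A k g \<longleftrightarrow>
    (\<exists>as. length as = k \<and> set as \<subseteq> A \<and> g = foldr (\<otimes>\<^bsub>G\<^esub>) as \<one>\<^bsub>G\<^esub>)"

lemma word_length_eq: "word_length G A g = (LEAST k. is_word_product G A k g)"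
  unfolding word_length_def is_word_product_def ..

lemma is_word_product_0 [simp]: "is_word_product G A 0 g \<longleftrightarrow> g = \<one>\<^bsub>G\<^esub>"
  by (auto simp: is_word_product_def)

lemma is_word_product_Suc:
  "is_word_product G A (Suc k) g \<longleftrightarrow> (\<exists>a\<in>A. \<exists>h. is_word_product G A k h \<and> g = a \<otimes>\<^bsub>G\<^esub> h)"
proof
  assume "is_word_product G A (Suc k) g"
  then obtain as where as: "length as = Suc k" "set as \<subseteq> A" "g = foldr (\<otimes>\<^bsub>G\<^esub>) as \<one>\<^bsub>G\<^esub>"
    by (auto simp: is_word_product_def)
  then obtain a bs where "as = a # bs"
    by (auto simp: length_Suc_conv)
  with as show "\<exists>a\<in>A. \<exists>h. is_word_product G A k h \<and> g = a \<otimes>\<^bsub>G\<^esub> h"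
    unfolding is_word_product_def by auto
next
  assume "\<exists>a\<in>A. \<exists>h. is_word_product G A k h \<and> g = a \<otimes>\<^bsub>G\<^esub> h"
  then obtain a as where "a \<in> A" "length as = k" "set as \<subseteq> A"
    "g = a \<otimes>\<^bsub>G\<^esub> foldr (\<otimes>\<^bsub>G\<^esub>) as \<one>\<^bsub>G\<^esub>"
    by (auto simp: is_word_product_def)
  then show "is_word_product G A (Suc k) g"
    unfolding is_word_product_def by (intro exI[of _ "a # as"]) auto
qed

text \<open>The premise, with an arbitrary \<open>k\<close>, supplies existence: without any product
  of elements of \<open>A\<close> the \<open>LEAST\<close> would be unspecified.\<close>

lemma is_word_product_word_length:
  "is_word_product G A k g \<Longrightarrow> is_word_product G A (word_length G A g) g"
  unfolding word_length_eq by (rule LeastI)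

lemma word_length_le: "is_word_product G A k g \<Longrightarrow> word_length G A g \<le> k"
  unfolding word_length_eq by (rule Least_le)

lemma (in monoid) is_word_product_closed:
  "A \<subseteq> carrier G \<Longrightarrow> is_word_product G A k g \<Longrightarrow> g \<in> carrier G"
  by (induction k arbitrary: g) (auto simp: is_word_product_Suc)

lemma (in monoid) is_word_product_mult:
  "A \<subseteq> carrier G \<Longrightarrow> is_word_product G A j g \<Longrightarrow> is_word_product G A k h \<Longrightarrow>
    is_word_product G A (j + k) (g \<otimes> h)"
proof (induction j arbitrary: g)
  case 0
  then show ?case by (simp add: is_word_product_closed)
next
  case (Suc j)
  then obtain a g' where "a \<in> A" "is_word_product G A j g'" "g = a \<otimes> g'"
    by (auto simp: is_word_product_Suc)
  with Suc show ?case
    by (auto simp: is_word_product_Suc m_assoc is_word_product_closed subset_iff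
        intro!: bexI[of _ a] exI[of _ "g' \<otimes> h"])
qed

section \<open>The sign character\<close>

text \<open>Cancellation removes two letters and a relator an even number of them, so parity of word
  length is an invariant of the presented group.\<close>

lemma presented_eq_even_length:
  assumes "presented_eq S R u v" and "\<And>r. r \<in> R \<Longrightarrow> even (length r)"
  shows "even (length u) \<longleftrightarrow> even (length v)"
  using assms(1) by induction (auto simp: assms(2))

section \<open>Evaluation of words in a group\<close>

lemma word_value_Nil [simp]: "word_value G [] = \<one>\<^bsub>G\<^esub>"
  by (simp add: word_value_def)

lemma word_value_Cons [simp]:
  "word_value G ((s, b) # w) = (if b then s else inv\<^bsub>G\<^esub> s) \<otimes>\<^bsub>G\<^esub> word_value G w"
  by (simp add: word_value_def)

lemma (in group) word_value_closed:
  "S \<subseteq> carrier G \<Longrightarrow> w \<in> words S \<Longrightarrow> word_value G w \<in> carrier G"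
  by (induction w) (auto simp: words_def)

lemma (in group) word_value_append:
  assumes "S \<subseteq> carrier G" "v \<in> words S" "u \<in> words S"
  shows "word_value G (u @ v) = word_value G u \<otimes> word_value G v"
  using assms(3)
proof (induction u)
  case Nil
  then show ?case using assms word_value_closed by simp
next
  case (Cons x u)
  then have "u \<in> words S" "fst x \<in> S" by (auto simp: words_def)
  with Cons assms show ?case
    using word_value_closed[OF assms(1)] by (cases x) (auto simp: m_assoc subset_iff)
qed

lemma (in group) generate_imp_word_value:
  assumes "S \<subseteq> carrier G" "g \<in> generate G S"
  shows "\<exists>w\<in>words S. word_value G w = g"
  using assms(2)
proof induction
  case one
  show ?case by (rule bexI[of _ "[]"]) (auto simp: words_def)
next
  case (incl h)
  then show ?case using assms(1) by (intro bexI[of _ "[(h, True)]"]) (auto simp: words_def)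
next
  case (inv h)
  then show ?case using assms(1) by (intro bexI[of _ "[(h, False)]"]) (auto simp: words_def)
next
  case (eng g h)
  then obtain u v where "u \<in> words S" "v \<in> words S" "word_value G u = g" "word_value G v = h"
    by auto
  then show ?case
    using word_value_append[OF assms(1)]
    by (intro bexI[of _ "u @ v"]) (auto simp: words_def)
qed

text \<open>Two words for the same element are related by \<open>presented_eq\<close>, and a Coxeter
  relator has length \<open>2 * n\<close>, so their lengths have the same parity. This parity
  defines the sign.\<close>

lemma sign_character_exists:
  assumes "coxeter_system W S"
  shows "\<exists>\<epsilon>. \<epsilon> \<in> hom W sign_img \<and> \<epsilon> \<in> extensional (carrier W) \<and> (\<forall>s\<in>S. \<epsilon> s = -1)"
proof -
  obtain m where pres: "has_presentation W S (coxeter_relators S m)"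
    using assms by (auto simp: coxeter_system_def)
  then interpret group W by (simp add: has_presentation_def)
  have S: "S \<subseteq> carrier W" and gen: "generate W S = carrier W"
    using pres by (auto simp: has_presentation_def)
  have even_relator: "even (length r)" if "r \<in> coxeter_relators S m" for r
  proof -
    have "even (length (concat (replicate n [(s, True), (t, True)])))" for n and s t :: 'a
      by (induction n) auto
    with that show ?thesis by (auto simp: coxeter_relators_def)
  qed
  have parity: "even (length u) \<longleftrightarrow> even (length v)"
    if "u \<in> words S" "v \<in> words S" "word_value W u = word_value W v" for u v
    using pres that presented_eq_even_length[OF _ even_relator]
    unfolding has_presentation_def by blast
  define word where "word g = (SOME w. w \<in> words S \<and> word_value W w = g)" for g
  have word: "word g \<in> words S" "word_value W (word g) = g" if "g \<in> carrier W" for g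
  proof -
    have "\<exists>w. w \<in> words S \<and> word_value W w = g"
      using generate_imp_word_value[OF S] that gen by blast
    then have "word g \<in> words S \<and> word_value W (word g) = g"
      unfolding word_def by (rule someI_ex)
    then show "word g \<in> words S" "word_value W (word g) = g" by auto
  qed
  define \<epsilon> where "\<epsilon> = (\<lambda>g\<in>carrier W. (- 1 :: int) ^ length (word g))"
  \<comment> \<open>The word chosen for the value of \<open>w\<close> need not be \<open>w\<close>
    itself; \<open>parity\<close> makes the choice immaterial.\<close>
  have \<epsilon>: "\<epsilon> (word_value W w) = (- 1) ^ length w" if "w \<in> words S" for w
    using that word[OF word_value_closed[OF S that]] parity[of "word (word_value W w)" w]
      word_value_closed[OF S that]
    by (simp add: \<epsilon>_def uminus_power_if)
  have "\<epsilon> (g \<otimes>\<^bsub>W\<^esub> h) = \<epsilon> g * \<epsilon> h" if "g \<in> carrier W" "h \<in> carrier W" for g h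
  proof -
    have "word g @ word h \<in> words S"
      using word that by (auto simp: words_def)
    moreover have "word_value W (word g @ word h) = g \<otimes>\<^bsub>W\<^esub> h"
      using word that S by (simp add: word_value_append)
    ultimately have "\<epsilon> (g \<otimes>\<^bsub>W\<^esub> h) = (- 1) ^ length (word g @ word h)"
      using \<epsilon> by metis
    then show ?thesis
      using that by (simp add: \<epsilon>_def power_add)
  qed
  moreover have "\<epsilon> g \<in> {-1, 1}" if "g \<in> carrier W" for g
    using that by (simp add: \<epsilon>_def uminus_power_if)
  ultimately have "\<epsilon> \<in> hom W sign_img"
    by (auto simp: hom_def sign_img_def)
  moreover have "\<epsilon> s = -1" if "s \<in> S" for s
    using \<epsilon>[of "[(s, True)]"] that S by (auto simp: words_def subset_iff)
  ultimately show ?thesis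
    by (auto simp: \<epsilon>_def)
qed

text \<open>Homomorphisms that agree on generators agree on the carrier, and extensionality fixes
  all other values. The description by \<open>THE\<close> requires this.\<close>

lemma sign_character_unique:
  assumes "group W" "generate W S = carrier W"
    and "\<epsilon> \<in> hom W sign_img" "\<epsilon> \<in> extensional (carrier W)" "\<forall>s\<in>S. \<epsilon> s = -1"
    and "\<delta> \<in> hom W sign_img" "\<delta> \<in> extensional (carrier W)" "\<forall>s\<in>S. \<delta> s = -1"
  shows "\<epsilon> = \<delta>"
proof (rule extensionalityI[OF assms(4) assms(7)])
  interpret W: group W by fact
  interpret sign: group sign_img by (rule sign_img_is_group)
  interpret e: group_hom W sign_img \<epsilon> by unfold_locales (rule assms(3))
  interpret d: group_hom W sign_img \<delta> by unfold_locales (rule assms(6))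
  fix g assume "g \<in> carrier W"
  then have "g \<in> generate W S" using assms(2) by simp
  then show "\<epsilon> g = \<delta> g"
  proof induction
    case one
    then show ?case by (simp add: e.hom_one d.hom_one)
  next
    case (incl h)
    then show ?case using assms by simp
  next
    case (inv h)
    then have "h \<in> carrier W" using generate.incl[of h S W] assms(2) by simp
    moreover have "\<epsilon> h = \<delta> h" using inv assms by simp
    ultimately show ?case by (simp only: e.hom_inv d.hom_inv)
  next
    case (eng g h)
    then have "g \<in> carrier W" "h \<in> carrier W" using assms(2) by auto
    with eng show ?case by simp
  qed
qed

lemma sign_character:
  assumes "coxeter_system W S"
  shows "sign_character W S \<in> hom W sign_img" "s \<in> S \<Longrightarrow> sign_character W S s = -1"
proof -
  have "group W" "generate W S = carrier W"
    using assms by (auto simp: coxeter_system_def has_presentation_def)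
  then have "\<exists>!\<epsilon>. \<epsilon> \<in> hom W sign_img \<and> \<epsilon> \<in> extensional (carrier W) \<and> (\<forall>s\<in>S. \<epsilon> s = -1)"
    using sign_character_exists[OF assms] sign_character_unique by blast
  from theI'[OF this] show "sign_character W S \<in> hom W sign_img"
    "s \<in> S \<Longrightarrow> sign_character W S s = -1"
    by (auto simp: sign_character_def)
qed

section \<open>Reflections and cosets of a simple reflection\<close>

locale pointed_coxeter_system = group W for W :: "('a, 'b) monoid_scheme" (structure) +
  fixes S :: "'a set" and s\<^sub>0 :: 'a
  assumes coxeter: "coxeter_system W S" and s0_in: "s\<^sub>0 \<in> S"
begin

abbreviation "T \<equiv> reflections W S"
abbreviation "H \<equiv> generate W {s\<^sub>0}"
abbreviation "\<epsilon> \<equiv> sign_character W S"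
abbreviation "Wp \<equiv> alternating_subgroup W S"

lemma S_carrier: "S \<subseteq> carrier W" and S_generates: "generate W S = carrier W"
  using coxeter by (auto simp: coxeter_system_def has_presentation_def)

lemma s0_carrier [simp]: "s\<^sub>0 \<in> carrier W"
  using S_carrier s0_in by auto

text \<open>The diagonal entry \<open>m s s = 1\<close> makes the word \<open>s s\<close> itself a
  relator, with exponent 1.\<close>

lemma S_square:
  assumes "s \<in> S"
  shows "s \<otimes> s = \<one>"
proof -
  obtain m where m: "coxeter_matrix S m" and pres: "has_presentation W S (coxeter_relators S m)"
    using coxeter by (auto simp: coxeter_system_def)
  let ?r = "[(s, True), (s, True)]"
  have "m s s = enat 1"
    using m assms by (simp add: coxeter_matrix_def one_enat_def)
  moreover have "?r = concat (replicate 1 ?r)" by simp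
  ultimately have "?r \<in> coxeter_relators S m"
    using assms unfolding coxeter_relators_def by blast
  then have "presented_eq S (coxeter_relators S m) ([] @ ?r @ []) ([] @ [])"
    by (intro presented_eq.relator) (auto simp: words_def)
  moreover have "?r \<in> words S" "[] \<in> words S"
    using assms by (auto simp: words_def)
  ultimately have "word_value W ?r = word_value W []"
    using pres unfolding has_presentation_def append_Nil append_Nil2 by blast
  moreover have "s \<in> carrier W"
    using assms S_carrier by auto
  ultimately show ?thesis by simp
qed

lemma S_inv: "s \<in> S \<Longrightarrow> inv s = s"
  using S_square S_carrier by (auto intro: inv_equality)

lemma s0_square [simp]: "s\<^sub>0 \<otimes> s\<^sub>0 = \<one>"
  using S_square s0_in by simp

lemma s0_inv [simp]: "inv s\<^sub>0 = s\<^sub>0"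
  using S_inv s0_in by simp

lemma H_eq: "H = {\<one>, s\<^sub>0}"
proof
  show "H \<subseteq> {\<one>, s\<^sub>0}"
  proof
    fix h assume "h \<in> H"
    then show "h \<in> {\<one>, s\<^sub>0}" by induction auto
  qed
  show "{\<one>, s\<^sub>0} \<subseteq> H"
    by (auto intro: generate.intros)
qed

lemma H_carrier: "H \<subseteq> carrier W"
  by (simp add: H_eq)

lemma coset_eq: "w \<in> carrier W \<Longrightarrow> w <# H = {w, w \<otimes> s\<^sub>0}"
  by (auto simp: H_eq l_coset_def)

lemma S_subset_T: "S \<subseteq> T"
proof
  fix s assume "s \<in> S"
  then have "s = \<one> \<otimes> s \<otimes> inv \<one>" using S_carrier by auto
  with \<open>s \<in> S\<close> show "s \<in> T" unfolding reflections_def by blast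
qed

lemma T_carrier: "T \<subseteq> carrier W"
  using S_carrier by (auto simp: reflections_def)

text \<open>Allows a reflection to be moved across a group element:
  \<open>g t = (g t (inv g)) g\<close>.\<close>

lemma T_conj:
  assumes "t \<in> T" "g \<in> carrier W"
  shows "g \<otimes> t \<otimes> inv g \<in> T"
proof -
  obtain w s where w: "w \<in> carrier W" "s \<in> S" "t = w \<otimes> s \<otimes> inv w"
    using assms by (auto simp: reflections_def)
  then have "g \<otimes> t \<otimes> inv g = (g \<otimes> w) \<otimes> s \<otimes> inv (g \<otimes> w)"
    using assms S_carrier by (auto simp: m_assoc inv_mult_group subset_iff)
  with w assms show ?thesis unfolding reflections_def by blast
qed

lemma T_inv:
  assumes "t \<in> T"
  shows "inv t = t"
proof -
  obtain w s where w: "w \<in> carrier W" "s \<in> S" "t = w \<otimes> s \<otimes> inv w"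
    using assms by (auto simp: reflections_def)
  then have "s \<in> carrier W" using S_carrier by auto
  then show ?thesis using w S_inv by (simp add: inv_mult_group m_assoc)
qed

section \<open>Signs of products, inverses and reflections\<close>

lemma sign_mult [simp]:
  "x \<in> carrier W \<Longrightarrow> y \<in> carrier W \<Longrightarrow> \<epsilon> (x \<otimes> y) = \<epsilon> x * \<epsilon> y"
  using sign_character(1)[OF coxeter] by (simp add: hom_def sign_img_def)

lemma sign_cases: "x \<in> carrier W \<Longrightarrow> \<epsilon> x = 1 \<or> \<epsilon> x = -1"
  using sign_character(1)[OF coxeter] by (auto simp: hom_def sign_img_def)

lemma sign_one [simp]: "\<epsilon> \<one> = 1"
proof -
  have "\<epsilon> (\<one> \<otimes> \<one>) = \<epsilon> \<one> * \<epsilon> \<one>"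
    by (rule sign_mult) simp_all
  then show ?thesis using sign_cases[of \<one>] by auto
qed

lemma sign_inv [simp]:
  assumes "x \<in> carrier W"
  shows "\<epsilon> (inv x) = \<epsilon> x"
  using assms sign_mult[of "inv x" x] sign_cases[of x] by auto

lemma sign_s0 [simp]: "\<epsilon> s\<^sub>0 = -1"
  using sign_character(2)[OF coxeter] s0_in by simp

lemma sign_T:
  assumes "t \<in> T"
  shows "\<epsilon> t = -1"
proof -
  obtain w s where w: "w \<in> carrier W" "s \<in> S" "t = w \<otimes> s \<otimes> inv w"
    using assms by (auto simp: reflections_def)
  then have "s \<in> carrier W" using S_carrier by auto
  then show ?thesis
    using w sign_character(2)[OF coxeter] sign_cases[of w] by auto
qed

lemma Wp_iff: "x \<in> Wp \<longleftrightarrow> x \<in> carrier W \<and> \<epsilon> x = 1"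
  by (auto simp: alternating_subgroup_def kernel_def sign_img_def)

text \<open>Products without inverses suffice, since the elements of \<open>S\<close> are
  involutions lying in \<open>T\<close>. Hence the minimum defining the absolute length is attained
  on all of \<open>W\<close>.\<close>

lemma T_generates: "w \<in> carrier W \<Longrightarrow> \<exists>k. is_word_product W T k w"
proof -
  assume "w \<in> carrier W"
  then have "w \<in> generate W S" using S_generates by simp
  then show ?thesis
  proof induction
    case one
    have "is_word_product W T 0 \<one>" by simp
    then show ?case ..
  next
    case (incl h)
    then have "is_word_product W T (Suc 0) h"
      using S_subset_T S_carrier by (auto simp: is_word_product_Suc intro!: bexI[of _ h])
    then show ?case ..
  next
    case (inv h)
    then have "is_word_product W T (Suc 0) (inv h)"
      using S_subset_T S_carrier S_inv
      by (auto simp: is_word_product_Suc intro!: bexI[of _ h])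
    then show ?case ..
  next
    case (eng g h)
    then show ?case using is_word_product_mult[OF T_carrier] by blast
  qed
qed

section \<open>The absolute order on cosets\<close>

abbreviation "\<l> \<equiv> coset_length W S"

lemma lcoset_carrier: "x \<in> lcosets H \<Longrightarrow> x \<subseteq> carrier W"
  by (auto simp: LCOSETS_def coset_eq)

lemma lcoset_translate: "x \<in> lcosets H \<Longrightarrow> w \<in> carrier W \<Longrightarrow> w <# x \<in> lcosets H"
  using H_carrier by (auto simp: LCOSETS_def lcos_m_assoc)

lemma lcoset_product_exists:
  assumes "x \<in> lcosets H"
  shows "\<exists>k. \<exists>w\<in>x. is_word_product W T k w"
proof -
  obtain w where "w \<in> carrier W" "w \<in> x"
    using assms by (auto simp: LCOSETS_def coset_eq)
  then show ?thesis using T_generates by blast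
qed

text \<open>Both nested minima are attained, so they merge into one. Afterwards any product of
  reflections lying in the coset bounds its length, without reference to shortest words.\<close>

lemma coset_length_eq:
  assumes "x \<in> lcosets H"
  shows "\<l> x = (LEAST k. \<exists>w\<in>x. is_word_product W T k w)"
  unfolding coset_length_def
proof (rule Least_equality)
  let ?L = "LEAST k. \<exists>w\<in>x. is_word_product W T k w"
  obtain w where w: "w \<in> x" "is_word_product W T ?L w"
    using LeastI_ex[OF lcoset_product_exists[OF assms]] by blast
  have least: "?L \<le> word_length W T v" if "v \<in> x" for v
  proof (rule Least_le)
    have "v \<in> carrier W" using that lcoset_carrier[OF assms] by blast
    then have "is_word_product W T (word_length W T v) v"
      using T_generates by (blast intro: is_word_product_word_length)
    then show "\<exists>v'\<in>x. is_word_product W T (word_length W T v) v'"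
      using that ..
  qed
  show "\<exists>w\<in>x. word_length W T w = ?L"
    using w word_length_le[OF w(2)] least[OF w(1)] by (intro bexI[of _ w]) auto
  show "?L \<le> y" if "\<exists>w\<in>x. word_length W T w = y" for y
    using that least by auto
qed

lemma coset_length_attained:
  "x \<in> lcosets H \<Longrightarrow> \<exists>w\<in>x. is_word_product W T (\<l> x) w"
  unfolding coset_length_eq by (rule LeastI_ex[OF lcoset_product_exists])

lemma coset_length_le:
  "x \<in> lcosets H \<Longrightarrow> w \<in> x \<Longrightarrow> is_word_product W T k w \<Longrightarrow> \<l> x \<le> k"
  unfolding coset_length_eq by (rule Least_le) blast

text \<open>Prepending the factors of \<open>w\<close> to a shortest product in \<open>x\<close>
  gives a product in \<open>w <# x\<close>. For \<open>k = 1\<close>: a reflection raises the length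
  by at most one.\<close>

lemma coset_length_translate:
  assumes "x \<in> lcosets H" "is_word_product W T k w"
  shows "\<l> (w <# x) \<le> k + \<l> x"
proof -
  obtain v where v: "v \<in> x" "is_word_product W T (\<l> x) v"
    using coset_length_attained[OF assms(1)] by blast
  have "w \<otimes> v \<in> w <# x" using v by (auto simp: l_coset_def)
  moreover have "w \<in> carrier W" by (rule is_word_product_closed[OF T_carrier assms(2)])
  ultimately show ?thesis
    using coset_length_le lcoset_translate[OF assms(1)]
      is_word_product_mult[OF T_carrier assms(2) v(2)] by blast
qed

text \<open>The counterpart of \<open>Abs0_step\<close> on cosets. Only a strict increase is
  demanded; by \<open>coset_length_translate\<close> it is then an increase by exactly one.\<close>

definition coset_step :: "('a set \<times> 'a set) set"
  where "coset_step = {(x, y). x \<in> lcosets H \<and> \<l> x < \<l> y \<and> (\<exists>t\<in>T. y = t <# x)}"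

lemma coset_step_closed: "(x, y) \<in> coset_step \<Longrightarrow> x \<in> lcosets H \<and> y \<in> lcosets H"
  using T_carrier lcoset_translate by (auto simp: coset_step_def subset_iff)

text \<open>Attaining the upper bound \<open>k + \<l> x\<close> leaves no slack: the
  \<open>k\<close> reflections, applied from right to left, must each raise the length by
  one.\<close>

lemma geodesic_coset_steps:
  assumes "x \<in> lcosets H" "is_word_product W T k w" "\<l> (w <# x) = k + \<l> x"
  shows "(x, w <# x) \<in> coset_step\<^sup>*"
  using assms(2,3)
proof (induction k arbitrary: w)
  case 0
  then show ?case using lcos_mult_one lcoset_carrier[OF assms(1)] by simp
next
  case (Suc k)
  then obtain t v where tv: "t \<in> T" "is_word_product W T k v" "w = t \<otimes> v"
    by (auto simp: is_word_product_Suc)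
  have carrier: "t \<in> carrier W" "v \<in> carrier W"
    using tv T_carrier is_word_product_closed[OF T_carrier] by auto
  have w: "w <# x = t <# (v <# x)"
    using tv carrier lcoset_carrier[OF assms(1)] by (simp add: lcos_m_assoc)
  have v: "v <# x \<in> lcosets H" using lcoset_translate assms(1) carrier by simp
  have "is_word_product W T 1 t"
    using tv carrier by (auto simp: is_word_product_Suc intro!: bexI[of _ t])
  \<comment> \<open>The bounds \<open>\<l> (w <# x) \<le> 1 + \<l> (v <# x)\<close> and
    \<open>\<l> (v <# x) \<le> k + \<l> x\<close> add up to the assumed value of
    \<open>\<l> (w <# x)\<close>, so both are equalities.\<close>
  from coset_length_translate[OF v this] coset_length_translate[OF assms(1) tv(2)] Suc.prems(2)
  have len: "\<l> (v <# x) = k + \<l> x" by (simp add: w)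
  have "(v <# x, w <# x) \<in> coset_step"
    using v w len Suc.prems(2) tv(1) by (auto simp: coset_step_def)
  with Suc.IH[OF tv(2) len] show ?case by simp
qed

text \<open>Each step raises the length by at least one by definition and by at most one by
  \<open>coset_length_translate\<close>. So the reflections along a path multiply to an element
  whose factor count is the total increase.\<close>

lemma coset_steps_geodesic:
  assumes "(x, y) \<in> coset_step\<^sup>*" "x \<in> lcosets H"
  shows "\<exists>w k. is_word_product W T k w \<and> y = w <# x \<and> \<l> y = k + \<l> x"
  using assms(1)
proof induction
  case base
  show ?case
    using lcos_mult_one lcoset_carrier[OF assms(2)]
    by (intro exI[of _ \<one>] exI[of _ 0]) simp
next
  case (step y z)
  then obtain w k where w: "is_word_product W T k w" "y = w <# x" "\<l> y = k + \<l> x" by blast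
  obtain t where t: "t \<in> T" "z = t <# y" "\<l> y < \<l> z"
    using step(2) by (auto simp: coset_step_def)
  have tw: "is_word_product W T (Suc k) (t \<otimes> w)"
    using t w by (auto simp: is_word_product_Suc)
  moreover have z: "z = (t \<otimes> w) <# x"
    using t w T_carrier is_word_product_closed[OF T_carrier w(1)] lcoset_carrier[OF assms(2)]
    by (auto simp: lcos_m_assoc)
  moreover have "\<l> z = Suc k + \<l> x"
    using coset_length_translate[OF assms(2) tw] w t(3) by (simp add: z)
  ultimately show ?case by blast
qed

text \<open>Gives the order on cosets the same shape as the order on the alternating subgroup: a
  closure of length-increasing steps.\<close>

lemma Abs_le_iff:
  assumes "x \<in> lcosets H"
  shows "x \<sqsubseteq>\<^bsub>Abs W S H\<^esub> y \<longleftrightarrow> (x, y) \<in> coset_step\<^sup>*"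
proof
  assume "x \<sqsubseteq>\<^bsub>Abs W S H\<^esub> y"
  then obtain w where w: "w \<in> carrier W" "y = w <# x" "\<l> y = word_length W T w + \<l> x"
    by (auto simp: Abs_def)
  moreover have "is_word_product W T (word_length W T w) w"
    using T_generates[OF w(1)] by (blast intro: is_word_product_word_length)
  ultimately show "(x, y) \<in> coset_step\<^sup>*"
    using geodesic_coset_steps assms by blast
next
  assume "(x, y) \<in> coset_step\<^sup>*"
  then obtain w k where w: "is_word_product W T k w" "y = w <# x" "\<l> y = k + \<l> x"
    using coset_steps_geodesic assms by blast
  \<comment> \<open>A product for \<open>w\<close> with fewer than \<open>k\<close> factors would
    force \<open>\<l> y < k + \<l> x\<close>.\<close>
  have "k \<le> word_length W T w"
    using coset_length_translate[OF assms is_word_product_word_length[OF w(1)]] w by simp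
  then have "word_length W T w = k"
    using word_length_le[OF w(1)] by simp
  then show "x \<sqsubseteq>\<^bsub>Abs W S H\<^esub> y"
    using w is_word_product_closed[OF T_carrier w(1)]
    by (auto simp: Abs_def intro!: bexI[of _ w])
qed

section \<open>The isomorphism\<close>

definition inv_coset :: "'a \<Rightarrow> 'a set"
  where "inv_coset u = inv u <# H"

lemma inv_coset_eq: "u \<in> carrier W \<Longrightarrow> inv_coset u = {inv u, inv u \<otimes> s\<^sub>0}"
  by (simp add: inv_coset_def coset_eq)

lemma inv_coset_in: "u \<in> carrier W \<Longrightarrow> inv_coset u \<in> lcosets H"
  by (auto simp: inv_coset_def LCOSETS_def)

text \<open>Inversion turns a leading \<open>s\<^sub>0\<close> into a trailing one, which
  \<open>H\<close> absorbs.\<close>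

lemma inv_coset_s0:
  assumes "u \<in> carrier W"
  shows "inv_coset (s\<^sub>0 \<otimes> u) = inv_coset u"
  using assms by (auto simp: inv_coset_eq inv_mult_group m_assoc)

lemma inv_coset_mult:
  assumes "u \<in> carrier W" "g \<in> carrier W"
  shows "inv_coset (u \<otimes> inv g) = g <# inv_coset u"
  using assms H_carrier by (simp add: inv_coset_def lcos_m_assoc inv_mult_group)

lemma inv_coset_bij: "bij_betw inv_coset Wp (lcosets H)"
  unfolding bij_betw_def
proof
  show "inj_on inv_coset Wp"
  proof (rule inj_onI)
    fix u v assume uv: "u \<in> Wp" "v \<in> Wp" "inv_coset u = inv_coset v"
    then have c: "u \<in> carrier W" "v \<in> carrier W" and e: "\<epsilon> u = 1" "\<epsilon> v = 1"
      by (auto simp: Wp_iff)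
    have "inv u \<in> {inv v, inv v \<otimes> s\<^sub>0}"
      using uv(3) c inv_coset_eq by auto
    moreover have "inv u \<noteq> inv v \<otimes> s\<^sub>0"
    proof
      assume "inv u = inv v \<otimes> s\<^sub>0"
      then have "\<epsilon> (inv u) = \<epsilon> (inv v \<otimes> s\<^sub>0)" by simp
      then show False using c e by simp
    qed
    ultimately show "u = v" using c inv_inj by (auto dest: inj_onD)
  qed
  show "inv_coset ` Wp = lcosets H"
  proof
    show "inv_coset ` Wp \<subseteq> lcosets H"
      using inv_coset_in by (auto simp: Wp_iff)
    show "lcosets H \<subseteq> inv_coset ` Wp"
    proof
      fix x assume "x \<in> lcosets H"
      then obtain w where w: "w \<in> carrier W" "x = w <# H"
        by (auto simp: LCOSETS_def)
      \<comment> \<open>Two candidates for the preimage; they differ by the factor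
        \<open>s\<^sub>0\<close> of sign -1, so one of them is even.\<close>
      have x: "x = inv_coset (inv w)" "x = inv_coset (s\<^sub>0 \<otimes> inv w)"
        using w inv_coset_s0[of "inv w"] by (auto simp: inv_coset_def)
      have "inv w \<in> Wp \<or> s\<^sub>0 \<otimes> inv w \<in> Wp"
        using w sign_cases[of w] by (auto simp: Wp_iff)
      then show "x \<in> inv_coset ` Wp" using x by blast
    qed
  qed
qed

lemma inv_coset_image: "inv_coset ` Wp = lcosets H"
  using inv_coset_bij by (simp add: bij_betw_def)

section \<open>Comparison of steps, lengths and paths under the bijection\<close>

lemma T0_mult_Wp:
  assumes "\<tau> \<in> T0 W S s\<^sub>0" "u \<in> Wp"
  shows "\<tau> \<otimes> u \<in> Wp"
  using assms T_carrier sign_T by (auto simp: T0_def Wp_iff subset_iff)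

text \<open>The reflections on the two sides are conjugate by \<open>u\<close>: since
  \<open>s\<^sub>0 t u = s\<^sub>0 u (inv u t u)\<close>, multiplying \<open>u\<close> by
  \<open>s\<^sub>0 t\<close> translates its coset by \<open>inv u t u\<close>.\<close>

lemma T0_step_iff:
  assumes "u \<in> Wp" "v \<in> Wp"
  shows "(\<exists>\<tau>\<in>T0 W S s\<^sub>0. v = \<tau> \<otimes> u) \<longleftrightarrow> (\<exists>t\<in>T. inv_coset v = t <# inv_coset u)"
proof -
  have u: "u \<in> carrier W" using assms by (simp add: Wp_iff)
  have translate: "inv_coset (s\<^sub>0 \<otimes> (u \<otimes> t)) = t <# inv_coset u" if "t \<in> T" for t
  proof -
    have "t \<in> carrier W" using that T_carrier by auto
    then show ?thesis
      using u that inv_coset_s0[of "u \<otimes> t"] inv_coset_mult[of u t] T_inv by simp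
  qed
  show ?thesis
  proof
    assume "\<exists>\<tau>\<in>T0 W S s\<^sub>0. v = \<tau> \<otimes> u"
    then obtain t where t: "t \<in> T" "v = s\<^sub>0 \<otimes> t \<otimes> u"
      by (auto simp: T0_def)
    have "t \<in> carrier W" using t T_carrier by auto
    then have "v = s\<^sub>0 \<otimes> (u \<otimes> (inv u \<otimes> t \<otimes> u))"
      using t u by (simp add: m_assoc[symmetric])
    moreover have "inv u \<otimes> t \<otimes> u \<in> T"
      using T_conj[OF t(1), of "inv u"] u by simp
    ultimately show "\<exists>t\<in>T. inv_coset v = t <# inv_coset u"
      using translate by blast
  next
    assume "\<exists>t\<in>T. inv_coset v = t <# inv_coset u"
    then obtain t where t: "t \<in> T" "inv_coset v = t <# inv_coset u" by blast
    have tc: "t \<in> carrier W" using t T_carrier by auto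
    have "s\<^sub>0 \<otimes> (u \<otimes> t) \<in> Wp"
      using assms(1) tc sign_T[OF t(1)] by (simp add: Wp_iff)
    \<comment> \<open>Both elements are even and have the same image under \<open>inv_coset\<close>,
      which is injective on \<open>Wp\<close>.\<close>
    then have "v = s\<^sub>0 \<otimes> (u \<otimes> t)"
      using translate[OF t(1)] t(2) assms(2) inv_coset_bij
      by (metis bij_betw_def inj_onD)
    also have "\<dots> = (s\<^sub>0 \<otimes> (u \<otimes> t \<otimes> inv u)) \<otimes> u"
      using u tc by (simp add: m_assoc)
    finally have "v = (s\<^sub>0 \<otimes> (u \<otimes> t \<otimes> inv u)) \<otimes> u" .
    moreover have "s\<^sub>0 \<otimes> (u \<otimes> t \<otimes> inv u) \<in> T0 W S s\<^sub>0"
      using T_conj[OF t(1) u] by (auto simp: T0_def)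
    ultimately show "\<exists>\<tau>\<in>T0 W S s\<^sub>0. v = \<tau> \<otimes> u" by blast
  qed
qed

lemma T0_product_in_Wp: "is_word_product W (T0 W S s\<^sub>0) k u \<Longrightarrow> u \<in> Wp"
  by (induction k arbitrary: u) (auto simp: is_word_product_Suc T0_mult_Wp, simp add: Wp_iff)

text \<open>Induction on \<open>k\<close>: on either side, splitting off the leftmost factor is one
  step, and \<open>T0_step_iff\<close> matches these steps.\<close>

lemma T0_product_iff:
  assumes "u \<in> Wp"
  shows "is_word_product W (T0 W S s\<^sub>0) k u \<longleftrightarrow> (\<exists>w\<in>inv_coset u. is_word_product W T k w)"
  using assms
proof (induction k arbitrary: u)
  case 0
  then have u: "u \<in> carrier W" "\<epsilon> u = 1" by (auto simp: Wp_iff)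
  \<comment> \<open>The coset of \<open>u\<close> also contains an odd element, which must not be
    the identity; otherwise a nontrivial \<open>u\<close> would get length 0.\<close>
  have "inv u \<otimes> s\<^sub>0 \<noteq> \<one>"
  proof
    assume "inv u \<otimes> s\<^sub>0 = \<one>"
    then have "\<epsilon> (inv u \<otimes> s\<^sub>0) = 1" by simp
    then show False using u by simp
  qed
  moreover have "\<one> = inv u \<longleftrightarrow> u = \<one>"
    using u by (metis inv_inv inv_one)
  ultimately show ?case
    using u by (auto simp: inv_coset_eq)
next
  case (Suc k)
  have uc: "u \<in> carrier W" using Suc.prems by (simp add: Wp_iff)
  have "is_word_product W (T0 W S s\<^sub>0) (Suc k) u \<longleftrightarrow>
      (\<exists>v\<in>Wp. is_word_product W (T0 W S s\<^sub>0) k v \<and> (\<exists>\<tau>\<in>T0 W S s\<^sub>0. u = \<tau> \<otimes> v))"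
    using T0_product_in_Wp by (auto simp: is_word_product_Suc)
  also have "\<dots> \<longleftrightarrow> (\<exists>v\<in>Wp. (\<exists>w\<in>inv_coset v. is_word_product W T k w) \<and>
      (\<exists>t\<in>T. inv_coset u = t <# inv_coset v))"
    using Suc.IH T0_step_iff Suc.prems by blast
  \<comment> \<open>By surjectivity of \<open>inv_coset\<close>, ranging over even \<open>v\<close>
    is the same as ranging over all cosets.\<close>
  also have "\<dots> \<longleftrightarrow> (\<exists>x\<in>lcosets H. (\<exists>w\<in>x. is_word_product W T k w) \<and>
      (\<exists>t\<in>T. inv_coset u = t <# x))"
    by (simp flip: inv_coset_image)
  also have "\<dots> \<longleftrightarrow> (\<exists>w\<in>inv_coset u. is_word_product W T (Suc k) w)"
  proof
    assume "\<exists>x\<in>lcosets H. (\<exists>w\<in>x. is_word_product W T k w) \<and> (\<exists>t\<in>T. inv_coset u = t <# x)"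
    then obtain x w t where "w \<in> x" "is_word_product W T k w" "t \<in> T" "inv_coset u = t <# x"
      by blast
    then show "\<exists>w\<in>inv_coset u. is_word_product W T (Suc k) w"
      by (intro bexI[of _ "t \<otimes> w"]) (auto simp: is_word_product_Suc l_coset_def)
  next
    assume "\<exists>w\<in>inv_coset u. is_word_product W T (Suc k) w"
    then obtain t w where w: "t \<in> T" "is_word_product W T k w" "t \<otimes> w \<in> inv_coset u"
      by (auto simp: is_word_product_Suc)
    have c: "t \<in> carrier W" "w \<in> carrier W"
      using w T_carrier is_word_product_closed[OF T_carrier] by auto
    \<comment> \<open>The preceding coset is \<open>t <# inv_coset u\<close>: as \<open>t\<close> is
      an involution, this coset contains \<open>w\<close>, and \<open>t\<close> maps it back to
      \<open>inv_coset u\<close>.\<close>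
    have "t \<otimes> (t \<otimes> w) \<in> t <# inv_coset u"
      using w(3) by (auto simp: l_coset_def)
    moreover have "t \<otimes> t = \<one>"
      using T_inv[OF w(1)] l_inv[OF c(1)] by simp
    ultimately have "w \<in> t <# inv_coset u" "inv_coset u = t <# (t <# inv_coset u)"
      using c lcos_mult_one lcoset_carrier[OF inv_coset_in[OF uc]]
      by (auto simp: lcos_m_assoc simp flip: m_assoc)
    moreover have "t <# inv_coset u \<in> lcosets H"
      using c lcoset_translate inv_coset_in[OF uc] by simp
    ultimately show "\<exists>x\<in>lcosets H. (\<exists>w\<in>x. is_word_product W T k w) \<and>
        (\<exists>t\<in>T. inv_coset u = t <# x)"
      using w by blast
  qed
  finally show ?case .
qed

text \<open>The predicates under the two \<open>LEAST\<close> operators agree for every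
  \<open>k\<close>. As each coset contains a product of reflections, the length with respect to
  \<open>T0 W S s\<^sub>0\<close> is a genuine minimum on \<open>Wp\<close>.\<close>

lemma T0_length_eq: "u \<in> Wp \<Longrightarrow> word_length W (T0 W S s\<^sub>0) u = \<l> (inv_coset u)"
  by (simp add: word_length_eq T0_product_iff coset_length_eq inv_coset_in Wp_iff)

lemma Abs0_step_iff:
  assumes "u \<in> Wp" "v \<in> Wp"
  shows "(u, v) \<in> Abs0_step W S s\<^sub>0 \<longleftrightarrow> (inv_coset u, inv_coset v) \<in> coset_step"
  using assms T0_step_iff[OF assms] T0_length_eq inv_coset_in
  by (auto simp: Abs0_step_def coset_step_def Wp_iff)

lemma Abs0_steps_iff:
  assumes "u \<in> Wp" "v \<in> Wp"
  shows "(u, v) \<in> (Abs0_step W S s\<^sub>0)\<^sup>* \<longleftrightarrow> (inv_coset u, inv_coset v) \<in> coset_step\<^sup>*"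
proof
  assume "(u, v) \<in> (Abs0_step W S s\<^sub>0)\<^sup>*"
  then show "(inv_coset u, inv_coset v) \<in> coset_step\<^sup>*"
  proof induction
    case (step y z)
    then have "y \<in> Wp" "z \<in> Wp" by (auto simp: Abs0_step_def)
    with step Abs0_step_iff show ?case by (meson rtrancl.rtrancl_into_rtrancl)
  qed simp
next
  \<comment> \<open>The endpoint is generalised to any coset \<open>x\<close> so that induction
    along the path applies; surjectivity of \<open>inv_coset\<close> lifts the intermediate
    cosets.\<close>
  have "\<forall>v\<in>Wp. x = inv_coset v \<longrightarrow> (u, v) \<in> (Abs0_step W S s\<^sub>0)\<^sup>*"
    if "(inv_coset u, x) \<in> coset_step\<^sup>*" for x
    using that
  proof induction
    case base
    then show ?case using assms(1) inv_coset_bij by (auto simp: bij_betw_def dest: inj_onD)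
  next
    case (step y z)
    have "y \<in> inv_coset ` Wp"
      using coset_step_closed[OF step(2)] by (simp add: inv_coset_image)
    then obtain v where v: "v \<in> Wp" "y = inv_coset v" by blast
    with step.IH have "(u, v) \<in> (Abs0_step W S s\<^sub>0)\<^sup>*" by simp
    moreover have "(v, v') \<in> Abs0_step W S s\<^sub>0" if "v' \<in> Wp" "z = inv_coset v'" for v'
      using step(2) v that by (simp add: Abs0_step_iff)
    ultimately show ?case by (blast intro: rtrancl_into_rtrancl)
  qed
  then show "(inv_coset u, inv_coset v) \<in> coset_step\<^sup>* \<Longrightarrow> (u, v) \<in> (Abs0_step W S s\<^sub>0)\<^sup>*"
    using assms(2) by blast
qed

section \<open>The partial order axioms and the conclusion\<close>

lemma coset_steps_antisym:
  assumes "(x, y) \<in> coset_step\<^sup>*" "(y, x) \<in> coset_step\<^sup>*"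
  shows "x = y"
proof -
  \<comment> \<open>A nonempty path strictly raises the length, so distinct cosets cannot be joined
    in both directions.\<close>
  have "x' = y' \<or> \<l> x' < \<l> y'" if "(x', y') \<in> coset_step\<^sup>*" for x' y'
    using that by induction (auto simp: coset_step_def)
  from this[OF assms(1)] this[OF assms(2)] show ?thesis by auto
qed

text \<open>In the closure form of \<open>Abs_le_iff\<close>, reflexivity and transitivity are
  immediate.\<close>

lemma partial_order_Abs: "partial_order (Abs W S H)"
proof -
  have c: "carrier (Abs W S H) = lcosets H" and e: "eq (Abs W S H) = (=)"
    by (simp_all add: Abs_def)
  show ?thesis
    by unfold_locales (auto simp: c e Abs_le_iff dest: coset_steps_antisym)
qed

lemma partial_order_Abs0: "partial_order (Abs0 W S s\<^sub>0)"
proof -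
  have c: "carrier (Abs0 W S s\<^sub>0) = Wp" and e: "eq (Abs0 W S s\<^sub>0) = (=)"
    and l: "le (Abs0 W S s\<^sub>0) = (\<lambda>u v. (u, v) \<in> (Abs0_step W S s\<^sub>0)\<^sup>*)"
    by (simp_all add: Abs0_def)
  have "u = v" if "u \<in> Wp" "v \<in> Wp" "(u, v) \<in> (Abs0_step W S s\<^sub>0)\<^sup>*"
    "(v, u) \<in> (Abs0_step W S s\<^sub>0)\<^sup>*" for u v
  proof -
    have "inv_coset u = inv_coset v"
      using that by (intro coset_steps_antisym) (simp_all flip: Abs0_steps_iff)
    then show ?thesis
      using that inv_coset_bij by (auto simp: bij_betw_def dest: inj_onD)
  qed
  then show ?thesis
    by unfold_locales (auto simp: c e l)
qed

lemma Abs0_isomorphic_Abs: "poset_isomorphic (Abs0 W S s\<^sub>0) (Abs W S H)"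
proof -
  have "u \<sqsubseteq>\<^bsub>Abs0 W S s\<^sub>0\<^esub> v \<longleftrightarrow> inv_coset u \<sqsubseteq>\<^bsub>Abs W S H\<^esub> inv_coset v"
    if "u \<in> Wp" "v \<in> Wp" for u v
    using that Abs0_steps_iff Abs_le_iff inv_coset_in by (simp add: Abs0_def Wp_iff)
  moreover have "carrier (Abs0 W S s\<^sub>0) = Wp" "carrier (Abs W S H) = lcosets H"
    by (simp_all add: Abs0_def Abs_def)
  ultimately show ?thesis
    using partial_order_Abs partial_order_Abs0 inv_coset_bij
    unfolding poset_isomorphic_def by auto
qed

end

theorem proposition5p6:
  fixes W :: "('a, 'b) monoid_scheme" and S :: "'a set" and s\<^sub>0 :: 'a
  assumes "coxeter_system W S"
    and "s\<^sub>0 \<in> S"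
  shows "poset_isomorphic (Abs0 W S s\<^sub>0) (Abs W S (generate W {s\<^sub>0}))"
proof -
  have "group W"
    using assms(1) by (auto simp: coxeter_system_def has_presentation_def)
  then interpret pointed_coxeter_system W S s\<^sub>0
    using assms by (simp add: pointed_coxeter_system_def pointed_coxeter_system_axioms_def)
  show ?thesis by (rule Abs0_isomorphic_Abs)
qed

end
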